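(* Let $\mathcal{G}$ be a weighted undirected graph on $V=\{1,\dots,N\}$, let $S\subseteq V$ be a set of vertices and $F\subseteq\{1,\dots,N\}$ a set of frequency indices, and let $\mathbf{D}$ and $\mathbf{B}$ be the associated vertex-limiting and frequency-limiting operators. There exists a nonzero vector $x\in\mathbb{R}^N$ that is perfectly localized over both the vertex set $S$ and the frequency set $F$ (i.e. $\mathbf{B}x=x$ and $\mathbf{D}x=x$) if and only if the matrix $\mathbf{B}\mathbf{D}\mathbf{B}$ has an eigenvalue equal to $1$. In such a case, $x$ is an eigenvector of $\mathbf{B}\mathbf{D}\mathbf{B}$ associated with the eigenvalue $1$.
   Context: $\mathcal{G}$ is a weighted undirected graph with vertex set $V=\{1,\dots,N\}$ and symmetric adjacency matrix $\mathbf{A}=(a_{ij})$, with $a_{ij}>0$ if there is a link between $i$ and $j$ and $a_{ij}=0$ otherwise. The degree matrix is $\mathbf{K}=\mathrm{diag}(d_1,\dots,d_N)$ with $d_i=\sum_{j}a_{ij}$, and the Laplacian is $\mathbf{L}=\mathbf{K}-\mathbf{A}$, a real symmetric positive semidefinite matrix. Fix an eigendecomposition $\mathbf{L}=\mathbf{U}\mathbf{\Lambda}\mathbf{U}^T$ with $\mathbf{U}$ a real orthogonal matrix whose columns are the eigenvectors. A signal on the graph is a vector in $\mathbb{R}^N$; its Graph Fourier Transform is $\hat f=\mathbf{U}^Tf$. For $S\subseteq V$, the vertex-limiting operator $\mathbf{D}$ is the diagonal $N\times N$ matrix with $D_{ii}=1$ if $i\in S$ and $D_{ii}=0$ otherwise.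 For $F\subseteq\{1,\dots,N\}$, the frequency-limiting operator is $\mathbf{B}=\mathbf{U}\mathbf{\Sigma}\mathbf{U}^T$, where $\mathbf{\Sigma}$ is the diagonal matrix with $\Sigma_{ii}=1$ if $i\in F$ and $\Sigma_{ii}=0$ otherwise. A vector $x$ is perfectly localized over $S$ and $F$ if $\mathbf{D}x=x$ and $\mathbf{B}x=x$. *)

theory Defs
  imports "Jordan_Normal_Form.Char_Poly"
begin

text \<open>
  Vertices and frequencies are indexed from \<open>0\<close>, following the matrix library: \<open>{0..<N}\<close>
  plays the role of \<open>{1,...,N}\<close>.
\<close>

text \<open>
  A weighted undirected graph is given by its adjacency matrix; \<open>i\<close> and \<open>j\<close> are linked iff
  the weight \<open>A $$ (i, j)\<close> is positive. Self-loops are not excluded.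
\<close>

definition weighted_graph :: "nat \<Rightarrow> real mat \<Rightarrow> bool" where
  "weighted_graph N A \<longleftrightarrow>
     A \<in> carrier_mat N N \<and> A\<^sup>T = A \<and> (\<forall>i<N. \<forall>j<N. A $$ (i, j) \<ge> 0)"

definition degree_matrix :: "nat \<Rightarrow> real mat \<Rightarrow> real mat" where
  "degree_matrix N A = mat_diag N (\<lambda>i. \<Sum>j = 0..<N. A $$ (i, j))"

definition laplacian :: "nat \<Rightarrow> real mat \<Rightarrow> real mat" where
  "laplacian N A = degree_matrix N A - A"

text \<open>
  Orthogonality is spelled out because the library's \<open>orthogonal_mat\<close> only asks for pairwise
  orthogonal nonzero columns, not for unit length.
\<close>

definition orthogonal_eigendecomposition ::
    "nat \<Rightarrow> real mat \<Rightarrow> real mat \<Rightarrow> real mat \<Rightarrow> bool" where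
  "orthogonal_eigendecomposition N L U \<Lambda> \<longleftrightarrow>
     U \<in> carrier_mat N N \<and> U * U\<^sup>T = 1\<^sub>m N \<and> U\<^sup>T * U = 1\<^sub>m N \<and>
     \<Lambda> \<in> carrier_mat N N \<and> diagonal_mat \<Lambda> \<and> L = U * \<Lambda> * U\<^sup>T"

definition selector :: "nat \<Rightarrow> nat set \<Rightarrow> real mat" where
  "selector N I = mat_diag N (\<lambda>i. if i \<in> I then 1 else 0)"

definition vertex_limiting :: "nat \<Rightarrow> nat set \<Rightarrow> real mat" where
  "vertex_limiting N S = selector N S"

definition frequency_limiting :: "nat \<Rightarrow> real mat \<Rightarrow> nat set \<Rightarrow> real mat" where
  "frequency_limiting N U F = U * selector N F * U\<^sup>T"

definition perfectly_localized ::
    "nat \<Rightarrow> real mat \<Rightarrow> nat set \<Rightarrow> nat set \<Rightarrow> real vec \<Rightarrow> bool" where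
  "perfectly_localized N U S F x \<longleftrightarrow>
     vertex_limiting N S *\<^sub>v x = x \<and> frequency_limiting N U F *\<^sub>v x = x"

end

theory Submission
  imports Defs
begin

text \<open>
  \<open>D\<close> and \<open>B\<close> are orthogonal projections. If \<open>B D B x = x\<close>, then \<open>x\<close> lies in the range of \<open>B\<close>,
  so \<open>\<langle>x, x\<rangle> = \<langle>x, B D x\<rangle> = \<langle>x, D x\<rangle> = \<langle>D x, D x\<rangle>\<close>; the projection \<open>D\<close> thus preserves the length
  of \<open>x\<close>, which forces \<open>D x = x\<close>.
\<close>

text \<open>Symmetry makes the projection orthogonal rather than oblique. Only these algebraic
  properties of \<open>D\<close> and \<open>B\<close> enter the main argument, so graph and spectrum
  can be left behind.\<close>

definition orthogonal_projection :: "nat \<Rightarrow> real mat \<Rightarrow> bool" where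
  "orthogonal_projection n P \<longleftrightarrow> P \<in> carrier_mat n n \<and> P\<^sup>T = P \<and> P * P = P"

lemma orthogonal_projection_mult_vec_idem:
  assumes "orthogonal_projection n P" and "x \<in> carrier_vec n"
  shows "P *\<^sub>v (P *\<^sub>v x) = P *\<^sub>v x"
proof -
  have "P * P *\<^sub>v x = P *\<^sub>v (P *\<^sub>v x)"
    using assms by (intro assoc_mult_mat_vec) (auto simp: orthogonal_projection_def)
  moreover have "P * P = P"
    using assms(1) by (simp add: orthogonal_projection_def)
  ultimately show ?thesis by (simp only:)
qed

lemma orthogonal_projection_scalar_prod:
  assumes "orthogonal_projection n P" and "x \<in> carrier_vec n" and "y \<in> carrier_vec n"
  shows "(P *\<^sub>v x) \<bullet> y = x \<bullet> (P *\<^sub>v y)"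
  using assms transpose_vec_mult_scalar[of P n n y x]
  by (simp add: orthogonal_projection_def)

lemma scalar_prod_self_eq_0_real:
  fixes v :: "real vec"
  assumes "v \<in> carrier_vec n" and "v \<bullet> v = 0"
  shows "v = 0\<^sub>v n"
  using assms by (intro eq_vecI) (auto simp: scalar_prod_def sum_nonneg_eq_0_iff)

lemma orthogonal_projection_selector: "orthogonal_projection n (selector n I)"
  unfolding orthogonal_projection_def selector_def
proof (intro conjI)
  show "(mat_diag n (\<lambda>i. if i \<in> I then 1 else 0 :: real))\<^sup>T = mat_diag n (\<lambda>i. if i \<in> I then 1 else 0)"
    by (rule eq_matI) (auto simp: mat_diag_def)
  show "mat_diag n (\<lambda>i. if i \<in> I then 1 else 0 :: real) * mat_diag n (\<lambda>i. if i \<in> I then 1 else 0)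
      = mat_diag n (\<lambda>i. if i \<in> I then 1 else 0)"
    unfolding mat_diag_diag by (rule arg_cong[where f = "mat_diag n"]) auto
qed simp

text \<open>In the square of the conjugate, the inner factor \<open>U\<^sup>T * U\<close> cancels
  and leaves \<open>P * P\<close>. This carries the projection property from the selector of
  \<open>F\<close> to \<open>B\<close>.\<close>

lemma orthogonal_projection_conjugate:
  assumes P: "orthogonal_projection n P"
    and U: "U \<in> carrier_mat n n" "U\<^sup>T * U = 1\<^sub>m n"
  shows "orthogonal_projection n (U * P * U\<^sup>T)"
proof -
  have c: "P \<in> carrier_mat n n" "P\<^sup>T = P" "P * P = P"
    using P by (auto simp: orthogonal_projection_def)
  have t: "(U * P * U\<^sup>T)\<^sup>T = U * P * U\<^sup>T"
    using c U by (simp add: transpose_mult[of _ n n _ n] assoc_mult_mat[of _ n n _ n _ n])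
  have "(U * P * U\<^sup>T) * (U * P * U\<^sup>T) = U * P * (U\<^sup>T * U) * P * U\<^sup>T"
    using c U(1) by (simp add: assoc_mult_mat[of _ n n _ n _ n])
  also have "\<dots> = U * (P * P) * U\<^sup>T"
    using c(1) U by (simp add: assoc_mult_mat[of _ n n _ n _ n])
  finally show ?thesis
    using c t U(1) by (simp add: orthogonal_projection_def)
qed

text \<open>Used with \<open>P = D\<close> and \<open>Q = B\<close>: being an equivalence for each
  single vector, it serves both the existence claim and the eigenvector claim.\<close>

lemma sandwiched_projection_fixed_iff:
  assumes P: "orthogonal_projection n P" and Q: "orthogonal_projection n Q"
    and x: "x \<in> carrier_vec n"
  shows "Q * P * Q *\<^sub>v x = x \<longleftrightarrow> P *\<^sub>v x = x \<and> Q *\<^sub>v x = x"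
proof -
  have c: "P \<in> carrier_mat n n" "Q \<in> carrier_mat n n"
    using P Q by (auto simp: orthogonal_projection_def)
  have eq: "Q * P * Q *\<^sub>v x = Q *\<^sub>v (P *\<^sub>v (Q *\<^sub>v x))"
    using c x by (simp add: assoc_mult_mat_vec[of _ n n _ n])
  show ?thesis
  proof
    assume "P *\<^sub>v x = x \<and> Q *\<^sub>v x = x"
    then show "Q * P * Q *\<^sub>v x = x" by (simp add: eq)
  next
    assume "Q * P * Q *\<^sub>v x = x"
    then have fx: "Q *\<^sub>v (P *\<^sub>v (Q *\<^sub>v x)) = x" by (simp add: eq)
    \<comment> \<open>By \<open>fx\<close>, \<open>x\<close> is itself an image under
      \<open>Q\<close>, and idempotence fixes every such image.\<close>
    have Qx: "Q *\<^sub>v x = x"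
      using orthogonal_projection_mult_vec_idem[OF Q, of "P *\<^sub>v (Q *\<^sub>v x)"] c x by (simp add: fx)
    have Px: "P *\<^sub>v x \<in> carrier_vec n" using c x by simp
    have "(P *\<^sub>v x) \<bullet> (P *\<^sub>v x) = x \<bullet> (P *\<^sub>v x)"
      using orthogonal_projection_scalar_prod[OF P x Px]
        orthogonal_projection_mult_vec_idem[OF P x] by simp
    \<comment> \<open>Since \<open>Q\<close> fixes \<open>x\<close>, it can be inserted on the left
      and moved across the product, where \<open>fx\<close> turns
      \<open>Q *\<^sub>v (P *\<^sub>v x)\<close> into \<open>x\<close>.\<close>
    moreover have "x \<bullet> x = x \<bullet> (P *\<^sub>v x)"
      using orthogonal_projection_scalar_prod[OF Q x Px] fx Qx by simp
    moreover have "(P *\<^sub>v x) \<bullet> x = x \<bullet> (P *\<^sub>v x)"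
      using orthogonal_projection_scalar_prod[OF P x x] .
    \<comment> \<open>Expanding the square gives four products, all equal to
      \<open>x \<bullet> (P *\<^sub>v x)\<close>, two with each sign.\<close>
    ultimately have "(P *\<^sub>v x - x) \<bullet> (P *\<^sub>v x - x) = 0"
      using x Px
      by (simp add: scalar_prod_minus_distrib[of _ n] minus_scalar_prod_distrib[of _ n])
    then have diff: "P *\<^sub>v x - x = 0\<^sub>v n"
      using scalar_prod_self_eq_0_real[of "P *\<^sub>v x - x" n] x Px by simp
    have "P *\<^sub>v x = x"
    proof (rule eq_vecI)
      fix i assume "i < dim_vec x"
      \<comment> \<open>Entries of \<open>P *\<^sub>v x\<close> must stay atomic here, not unfold
        into row products, so that the entry of \<open>diff\<close> gives the equation
        directly.\<close>
      then show "(P *\<^sub>v x) $ i = x $ i"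
        using arg_cong[OF diff, of "\<lambda>v. v $ i"] x Px by (simp del: index_mult_mat_vec)
    qed (use x c in auto)
    with Qx show "P *\<^sub>v x = x \<and> Q *\<^sub>v x = x" by simp
  qed
qed

theorem theorem2p1:
  fixes N :: nat and A U \<Lambda> D B :: "real mat" and S F :: "nat set"
  assumes "weighted_graph N A"
    and "orthogonal_eigendecomposition N (laplacian N A) U \<Lambda>"
    and "S \<subseteq> {0..<N}" and "F \<subseteq> {0..<N}"
    and "D = vertex_limiting N S" and "B = frequency_limiting N U F"
  shows "((\<exists>x \<in> carrier_vec N. x \<noteq> 0\<^sub>v N \<and> perfectly_localized N U S F x)
            \<longleftrightarrow> eigenvalue (B * D * B) 1) \<and>
         (\<forall>x \<in> carrier_vec N. x \<noteq> 0\<^sub>v N \<and> perfectly_localized N U S F x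
            \<longrightarrow> eigenvector (B * D * B) x 1)"
proof -
  have D: "orthogonal_projection N D"
    using assms(5) by (simp add: vertex_limiting_def orthogonal_projection_selector)
  have B: "orthogonal_projection N B"
    using assms(2,6) unfolding orthogonal_eigendecomposition_def frequency_limiting_def
    by (simp add: orthogonal_projection_conjugate orthogonal_projection_selector)
  \<comment> \<open>\<open>eigenvector\<close> takes its carrier and its zero vector from
    \<open>dim_row\<close> of the matrix.\<close>
  have "dim_row (B * D * B) = N"
    using B by (auto simp: orthogonal_projection_def)
  then have "eigenvector (B * D * B) x 1 \<longleftrightarrow>
      x \<in> carrier_vec N \<and> x \<noteq> 0\<^sub>v N \<and> perfectly_localized N U S F x" for x
    using sandwiched_projection_fixed_iff[OF D B, of x] assms(5,6)
    by (auto simp: eigenvector_def perfectly_localized_def)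
  then show ?thesis
    unfolding eigenvalue_def by blast
qed

end
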